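(* Let $\mathbf{x}_1,\ldots,\mathbf{x}_m\in\mathbb{R}^p$ be pairwise distinct vectors, let $1\le t<m$, and let $k\in\{1,\ldots,m\}\setminus\{1,\ldots,t\}$. Let $$E:=\Big\{\sum_{j=1}^{t}\lambda_j(\mathbf{x}_j-\mathbf{x}_k):\ \lambda_1,\ldots,\lambda_t\ge 0\Big\}+\mathbb{R}^p_+ .$$ There exists an increasing quasi-concave function $\vartheta:\mathbb{R}^p\to\mathbb{R}$ satisfying $\vartheta(\mathbf{x}_j)>\vartheta(\mathbf{x}_k)$ for all $j=1,2,\ldots,t$ if and only if $E$ is pointed. Moreover, if $E$ is pointed, such a function can be defined as follows: there exists $\bar\epsilon>0$ such that the cone $E^{\bar\epsilon}$ is pointed, and for any such $\bar\epsilon$ the function $$\vartheta(\mathbf{x}):=\mathrm{dist}(\mathbf{x}-\mathbf{x}_k;\mathbb{R}^p\setminus E^{\bar\epsilon})-\mathrm{dist}(\mathbf{x}-\mathbf{x}_k;E^{\bar\epsilon}),\qquad \mathbf{x}\in\mathbb{R}^p,$$ is increasing, quasi-concave, and satisfies $\vartheta(\mathbf{x}_j)>\vartheta(\mathbf{x}_k)$ for all $j=1,\ldots,t$.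
   Context: Vector inequalities are understood componentwise; $\mathbb{R}^p_+=\{\mathbf{x}\in\mathbb{R}^p:\mathbf{x}\ge\mathbf{0}\}$; $\mathbf{e}\in\mathbb{R}^p$ is the vector all of whose components equal one. For $\epsilon>0$, $$E^{\epsilon}:=\Big\{\sum_{j=1}^{t}\lambda_j(\mathbf{x}_j-\epsilon\mathbf{e}-\mathbf{x}_k):\ \lambda_1,\ldots,\lambda_t\ge 0\Big\}+\mathbb{R}^p_+ .$$ A convex cone $C$ is pointed if $C\cap(-C)=\{\mathbf{0}\}$. For nonempty $\Omega\subset\mathbb{R}^p$, $\mathrm{dist}(\mathbf{x};\Omega):=\inf_{\omega\in\Omega}\|\mathbf{x}-\omega\|$ with the Euclidean norm. A function $f:\mathbb{R}^p\to\mathbb{R}$ is quasi-concave if $f(\lambda\mathbf{x}+(1-\lambda)\mathbf{y})\ge\min\{f(\mathbf{x}),f(\mathbf{y})\}$ for all $\mathbf{x},\mathbf{y}\in\mathbb{R}^p$ and $\lambda\in[0,1]$. It is increasing if $\mathbf{x}\le\mathbf{y}$ implies $f(\mathbf{x})\le f(\mathbf{y})$. *)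

theory Defs
  imports "HOL-Analysis.Analysis"
begin

text \<open>
  Vectors in Euclidean p-space are elements of \<^typ>\<open>real^'p\<close>.  On this type the library's order
  is componentwise, \<^term>\<open>1 :: real^'p\<close> is the all-ones vector, the addition of sets is the
  Minkowski sum, and \<^const>\<open>infdist\<close> is the Euclidean distance to a set (with the
  value 0 for the empty set).
\<close>

definition prefcone :: "(nat \<Rightarrow> real^'p) \<Rightarrow> nat \<Rightarrow> nat \<Rightarrow> (real^'p) set" where
  "prefcone x t k =
     {\<Sum>j=1..t. \<mu> j *\<^sub>R (x j - x k) | \<mu>. \<forall>j\<in>{1..t}. 0 \<le> \<mu> j} + {y. 0 \<le> y}"

definition prefcone_eps :: "real \<Rightarrow> (nat \<Rightarrow> real^'p) \<Rightarrow> nat \<Rightarrow> nat \<Rightarrow> (real^'p) set" where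
  "prefcone_eps \<epsilon> x t k =
     {\<Sum>j=1..t. \<mu> j *\<^sub>R (x j - \<epsilon> *\<^sub>R 1 - x k) | \<mu>. \<forall>j\<in>{1..t}. 0 \<le> \<mu> j} + {y. 0 \<le> y}"

text \<open>Pointedness is only meant for convex cones; see the lemmas on the two cones below.\<close>

definition pointed :: "'a::real_vector set \<Rightarrow> bool" where
  "pointed C \<longleftrightarrow> C \<inter> uminus ` C = {0}"

definition quasi_concave :: "(real^'p \<Rightarrow> real) \<Rightarrow> bool" where
  "quasi_concave f \<longleftrightarrow>
     (\<forall>x y. \<forall>\<mu>\<in>{0..1}. f (\<mu> *\<^sub>R x + (1 - \<mu>) *\<^sub>R y) \<ge> min (f x) (f y))"

definition signed_dist :: "(real^'p) set \<Rightarrow> real^'p \<Rightarrow> real" where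
  "signed_dist C y = infdist y (UNIV - C) - infdist y C"

lemma convex_cone_gen:
  fixes d :: "nat \<Rightarrow> real^'p" and t :: nat
  defines "G \<equiv> {\<Sum>j=1..t. \<mu> j *\<^sub>R d j | \<mu>. \<forall>j\<in>{1..t}. 0 \<le> \<mu> j} + {y. 0 \<le> y}"
  shows "convex G" and "cone G" and "0 \<in> G"
proof -
  have memI: "(\<Sum>j=1..t. \<mu> j *\<^sub>R d j) + y \<in> G"
    if "\<forall>j\<in>{1..t}. 0 \<le> \<mu> j" "0 \<le> y" for \<mu> y
    unfolding G_def
  proof (rule set_plus_intro)
    show "(\<Sum>j=1..t. \<mu> j *\<^sub>R d j) \<in> {\<Sum>j=1..t. \<mu> j *\<^sub>R d j | \<mu>. \<forall>j\<in>{1..t}. 0 \<le> \<mu> j}"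
      by (rule CollectI, rule exI[of _ \<mu>], rule conjI[OF refl that(1)])
    show "y \<in> {y. 0 \<le> y}"
      by (rule CollectI, rule that(2))
  qed
  have memE: thesis
    if "v \<in> G"
      and *: "\<And>\<mu> y. v = (\<Sum>j=1..t. \<mu> j *\<^sub>R d j) + y \<Longrightarrow> \<forall>j\<in>{1..t}. 0 \<le> \<mu> j \<Longrightarrow> 0 \<le> y \<Longrightarrow> thesis"
    for v thesis
    using that(1) unfolding G_def
  proof (rule set_plus_elim)
    fix a y assume v: "v = a + y" and y: "y \<in> {y. 0 \<le> y}"
      and "a \<in> {\<Sum>j=1..t. \<mu> j *\<^sub>R d j | \<mu>. \<forall>j\<in>{1..t}. 0 \<le> \<mu> j}"
    then obtain \<mu> where "a = (\<Sum>j=1..t. \<mu> j *\<^sub>R d j)" "\<forall>j\<in>{1..t}. 0 \<le> \<mu> j"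
      by (elim CollectE exE conjE)
    with v y show thesis
      by (intro *[of \<mu> y]) (simp_all only: mem_Collect_eq)
  qed
  show zero: "0 \<in> G"
    using memI[of "\<lambda>_. 0" 0] by simp
  show cone: "cone G"
    unfolding cone_def
  proof (intro ballI allI impI)
    fix v and c :: real assume "v \<in> G" and c: "0 \<le> c"
    obtain \<mu> y where v: "v = (\<Sum>j=1..t. \<mu> j *\<^sub>R d j) + y"
      and l: "\<forall>j\<in>{1..t}. 0 \<le> \<mu> j" and y: "0 \<le> y"
      by (rule memE[OF \<open>v \<in> G\<close>])
    have "c *\<^sub>R v = (\<Sum>j=1..t. (c * \<mu> j) *\<^sub>R d j) + c *\<^sub>R y"
      by (simp add: v scaleR_add_right scaleR_sum_right)
    also have "\<dots> \<in> G"
      using l y c by (intro memI) (simp_all add: less_eq_vec_def)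
    finally show "c *\<^sub>R v \<in> G" .
  qed
  have "v + w \<in> G" if vw: "v \<in> G" "w \<in> G" for v w
  proof -
    obtain \<mu> y where v: "v = (\<Sum>j=1..t. \<mu> j *\<^sub>R d j) + y"
      and l: "\<forall>j\<in>{1..t}. 0 \<le> \<mu> j" and y: "0 \<le> y"
      by (rule memE[OF vw(1)])
    obtain \<nu> z where w: "w = (\<Sum>j=1..t. \<nu> j *\<^sub>R d j) + z"
      and m: "\<forall>j\<in>{1..t}. 0 \<le> \<nu> j" and z: "0 \<le> z"
      by (rule memE[OF vw(2)])
    have "v + w = (\<Sum>j=1..t. (\<mu> j + \<nu> j) *\<^sub>R d j) + (y + z)"
      by (simp add: v w scaleR_add_left sum.distrib)
    also have "\<dots> \<in> G"
      using l m y z by (intro memI) (simp_all add: less_eq_vec_def)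
    finally show ?thesis .
  qed
  with cone show "convex G"
    unfolding convex_def cone_def by blast
qed

lemma prefcone_convex_cone:
  "convex (prefcone x t k)" "cone (prefcone x t k)" "0 \<in> prefcone x t k"
  unfolding prefcone_def by (rule convex_cone_gen)+

lemma prefcone_eps_convex_cone:
  "convex (prefcone_eps \<epsilon> x t k)" "cone (prefcone_eps \<epsilon> x t k)" "0 \<in> prefcone_eps \<epsilon> x t k"
  unfolding prefcone_eps_def by (rule convex_cone_gen)+

end

theory Submission
  imports Defs
begin

text \<open>
  The cone generated by \<open>d\<^sub>1, \<dots>, d\<^sub>t\<close> and the nonnegative orthant can only fail to be pointed if
  some convex combination of the \<open>d\<^sub>j\<close> is \<open>\<le> 0\<close>.  For \<open>d\<^sub>j = x\<^sub>j - x\<^sub>k\<close> this contradicts the existence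
  of \<open>\<theta>\<close>.  Conversely, if \<open>E\<close> is pointed then \<open>E - {0}\<close> is convex, so the convex hull
  of the \<open>x\<^sub>j - x\<^sub>k\<close> is a compact set disjoint from the closed nonpositive orthant; the positive
  distance between the two leaves room for the shift by \<open>\<epsilon>\<close>.  The signed distance to a convex
  set with nonempty complement is quasi-concave because its superlevel sets are either parallel
  bodies of the set or sets of centres of balls contained in the set.
\<close>

section \<open>Cones generated by finitely many vectors and the nonnegative orthant\<close>

definition gencone :: "(nat \<Rightarrow> real^'p) \<Rightarrow> nat \<Rightarrow> (real^'p) set" where
  "gencone d t = {\<Sum>j=1..t. \<mu> j *\<^sub>R d j | \<mu>. \<forall>j\<in>{1..t}. 0 \<le> \<mu> j} + {y. 0 \<le> y}"

lemma prefcone_eq_gencone: "prefcone x t k = gencone (\<lambda>j. x j - x k) t"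
  by (simp add: prefcone_def gencone_def)

lemma prefcone_eps_eq_gencone: "prefcone_eps \<epsilon> x t k = gencone (\<lambda>j. x j - \<epsilon> *\<^sub>R 1 - x k) t"
  by (simp add: prefcone_eps_def gencone_def)

lemma gencone_convex_cone: "convex (gencone d t)" "cone (gencone d t)" "0 \<in> gencone d t"
  unfolding gencone_def by (rule convex_cone_gen)+

lemma genconeE:
  assumes "v \<in> gencone d t"
  obtains \<mu> y where "v = (\<Sum>j=1..t. \<mu> j *\<^sub>R d j) + y" "\<forall>j\<in>{1..t}. 0 \<le> \<mu> j" "0 \<le> y"
  using assms unfolding gencone_def by (elim set_plus_elim) blast

lemma gencone_add: "v \<in> gencone d t \<Longrightarrow> w \<in> gencone d t \<Longrightarrow> v + w \<in> gencone d t"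
  using gencone_convex_cone(1,2) convex_cone by blast

lemma nonneg_in_gencone:
  assumes "0 \<le> y" shows "y \<in> gencone d t"
proof -
  have "(\<Sum>j=1..t. 0 *\<^sub>R d j) + y \<in> gencone d t"
    unfolding gencone_def by (intro set_plus_intro CollectI exI[of _ "\<lambda>_. 0"] conjI refl assms) auto
  then show ?thesis by simp
qed

lemma generator_in_gencone:
  assumes "i \<in> {1..t}" shows "d i \<in> gencone d t"
proof -
  have "(\<Sum>j=1..t. (if j = i then 1 else 0) *\<^sub>R d j) + 0 \<in> gencone d t"
    unfolding gencone_def
    by (intro set_plus_intro CollectI exI[of _ "\<lambda>j. if j = i then 1 else 0"] conjI refl) auto
  also have "(\<Sum>j=1..t. (if j = i then 1 else 0) *\<^sub>R d j) = (\<Sum>j=1..t. if j = i then d j else 0)"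
    by (intro sum.cong) auto
  finally show ?thesis using assms by simp
qed

text \<open>Adding representations of some \<open>v\<close> and of \<open>- v\<close>, with
  \<open>v\<close> nonzero, cancels the left side: the summed coefficients \<open>c\<close> combine
  the generators to \<open>- (y + z)\<close>, which is nonpositive. Dividing by the total weight
  gives a convex combination.\<close>

lemma not_pointed_gencone:
  assumes "\<not> pointed (gencone d t)"
  obtains w where "\<forall>j\<in>{1..t}. 0 \<le> w j" "(\<Sum>j=1..t. w j) = 1" "(\<Sum>j=1..t. w j *\<^sub>R d j) \<le> 0"
proof -
  have "0 \<in> gencone d t \<inter> uminus ` gencone d t"
    using gencone_convex_cone(3)[of d t] by force
  with assms obtain v where v: "v \<in> gencone d t" "- v \<in> gencone d t" "v \<noteq> 0"
    unfolding pointed_def by fastforce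
  obtain a y where a: "v = (\<Sum>j=1..t. a j *\<^sub>R d j) + y" "\<forall>j\<in>{1..t}. 0 \<le> a j" "0 \<le> y"
    using v(1) by (rule genconeE)
  obtain b z where b: "- v = (\<Sum>j=1..t. b j *\<^sub>R d j) + z" "\<forall>j\<in>{1..t}. 0 \<le> b j" "0 \<le> z"
    using v(2) by (rule genconeE)
  define c where "c j = a j + b j" for j
  define s where "s = (\<Sum>j=1..t. c j)"
  have c0: "\<forall>j\<in>{1..t}. 0 \<le> c j" using a b by (simp add: c_def)
  have "(\<Sum>j=1..t. c j *\<^sub>R d j) + (y + z) = v + - v"
    unfolding b(1) unfolding a(1) c_def
    by (simp only: scaleR_add_left sum.distrib ac_simps)
  then have eq: "(\<Sum>j=1..t. c j *\<^sub>R d j) = - (y + z)"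
    by (simp only: eq_neg_iff_add_eq_0 right_minus)
  have le: "(\<Sum>j=1..t. c j *\<^sub>R d j) \<le> 0"
    unfolding eq neg_le_0_iff_le using a(3) b(3) by (rule add_nonneg_nonneg)
  \<comment> \<open>Zero total weight would leave \<open>v = y\<close> and \<open>y + z = 0\<close>
    with \<open>y\<close> and \<open>z\<close> nonnegative, hence \<open>v = 0\<close>.\<close>
  have "s \<noteq> 0"
  proof
    assume "s = 0"
    then have c: "\<forall>j\<in>{1..t}. c j = 0"
      using c0 unfolding s_def by (subst (asm) sum_nonneg_eq_0_iff) auto
    then have "\<forall>j\<in>{1..t}. a j = 0" using a(2) b(2) by (force simp: c_def)
    then have "v = y" using a(1) by simp
    moreover have "(\<Sum>j=1..t. c j *\<^sub>R d j) = 0" using c by simp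
    then have "y + z = 0" unfolding eq by (simp only: neg_equal_0_iff_equal)
    then have "y = 0" using a(3) b(3) by (simp add: add_nonneg_eq_0_iff)
    ultimately show False using v(3) by simp
  qed
  moreover have "s \<ge> 0" unfolding s_def using c0 by (intro sum_nonneg) auto
  ultimately have s: "s > 0" by simp
  show thesis
  proof (rule that[of "\<lambda>j. c j / s"])
    show "\<forall>j\<in>{1..t}. 0 \<le> c j / s" using c0 s by simp
    show "(\<Sum>j=1..t. c j / s) = 1" using s by (simp add: s_def flip: sum_divide_distrib)
    have "(\<Sum>j=1..t. (c j / s) *\<^sub>R d j) = (1 / s) *\<^sub>R (\<Sum>j=1..t. c j *\<^sub>R d j)"
      by (simp add: scaleR_sum_right)
    also have "\<dots> \<le> 0" using le s by (intro scaleR_nonneg_nonpos) auto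
    finally show "(\<Sum>j=1..t. (c j / s) *\<^sub>R d j) \<le> 0" .
  qed
qed

section \<open>Perturbing the generators of a pointed cone\<close>

lemma pointed_eq_0:
  assumes "pointed C" "v \<in> C" "- v \<in> C"
  shows "v = 0"
  using assms unfolding pointed_def by (metis IntI equation_minus_iff imageI singletonD)

text \<open>If a convex combination of two elements vanishes, its two summands are opposite elements
  of the cone, so both are zero; since \<open>1 - a\<close> and \<open>a\<close> are not both zero,
  one of the two elements is zero.\<close>

lemma pointed_convex_cone_minus_0:
  assumes "convex C" "cone C" "pointed C"
  shows "convex (C - {0})"
  unfolding convex_alt
proof (intro ballI allI impI)
  fix u v and a :: real assume u: "u \<in> C - {0}" and v: "v \<in> C - {0}" and a: "0 \<le> a \<and> a \<le> 1"
  have C: "(1 - a) *\<^sub>R u + a *\<^sub>R v \<in> C"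
    using assms(1) u v a unfolding convex_alt by blast
  moreover have "(1 - a) *\<^sub>R u + a *\<^sub>R v \<noteq> 0"
  proof
    assume "(1 - a) *\<^sub>R u + a *\<^sub>R v = 0"
    then have "- ((1 - a) *\<^sub>R u) = a *\<^sub>R v" by (metis minus_unique)
    moreover have "(1 - a) *\<^sub>R u \<in> C" "a *\<^sub>R v \<in> C"
      using assms(2) u v a unfolding cone_def by auto
    ultimately have "(1 - a) *\<^sub>R u = 0" using pointed_eq_0[OF assms(3)] by metis
    moreover have "a *\<^sub>R v = 0"
      unfolding \<open>- ((1 - a) *\<^sub>R u) = a *\<^sub>R v\<close>[symmetric] calculation by simp
    ultimately show False using u v by auto
  qed
  ultimately show "(1 - a) *\<^sub>R u + a *\<^sub>R v \<in> C - {0}" by simp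
qed

lemma pointed_gencone_perturb:
  fixes d :: "nat \<Rightarrow> real^'p"
  assumes pt: "pointed (gencone d t)" and nz: "\<And>j. j \<in> {1..t} \<Longrightarrow> d j \<noteq> 0"
  obtains \<epsilon> where "\<epsilon> > 0" "pointed (gencone (\<lambda>j. d j - \<epsilon> *\<^sub>R 1) t)"
proof -
  let ?H = "convex hull (d ` {1..t})" and ?N = "{..0::real^'p}"
  have "d ` {1..t} \<subseteq> gencone d t - {0}"
  proof
    fix v assume "v \<in> d ` {1..t}"
    then obtain j where "j \<in> {1..t}" "v = d j" by blast
    then show "v \<in> gencone d t - {0}" using nz[of j] generator_in_gencone[of j t d] by simp
  qed
  then have "?H \<subseteq> gencone d t - {0}"
    by (intro hull_minimal pointed_convex_cone_minus_0 gencone_convex_cone pt)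
  moreover have "h = 0" if "h \<in> gencone d t" "h \<le> 0" for h
    using pointed_eq_0[OF pt that(1)] nonneg_in_gencone[of "- h" d t] that(2) by simp
  ultimately have "?H \<inter> ?N = {}" by auto
  moreover have "compact ?H" by (simp add: finite_imp_compact_convex_hull)
  moreover have "closed ?N" by simp
  ultimately obtain \<delta> where \<delta>: "\<delta> > 0" "\<forall>u\<in>?H. \<forall>v\<in>?N. \<delta> \<le> dist u v"
    using separate_compact_closed by blast
  have n1: "norm (1::real^'p) > 0" by simp
  \<comment> \<open>With this choice the shift by \<open>\<epsilon> *\<^sub>R 1\<close> has length
    \<open>\<delta> / 2\<close>. It would bring a point \<open>h\<close> of the hull closer than
    \<open>\<delta>\<close> to the nonpositive orthant if the shifted cone were not pointed.\<close>
  define \<epsilon> where "\<epsilon> = \<delta> / (2 * norm (1::real^'p))"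
  have \<epsilon>: "\<epsilon> > 0" using \<delta>(1) n1 by (simp add: \<epsilon>_def)
  have "pointed (gencone (\<lambda>j. d j - \<epsilon> *\<^sub>R 1) t)"
  proof (rule ccontr)
    assume "\<not> ?thesis"
    then obtain w where w: "\<forall>j\<in>{1..t}. 0 \<le> w j" "(\<Sum>j=1..t. w j) = 1"
      "(\<Sum>j=1..t. w j *\<^sub>R (d j - \<epsilon> *\<^sub>R 1)) \<le> 0"
      by (rule not_pointed_gencone)
    define h where "h = (\<Sum>j=1..t. w j *\<^sub>R d j)"
    have "h \<in> ?H" unfolding h_def
      using w(1,2) by (intro convex_sum) (auto intro: hull_inc)
    moreover have "(\<Sum>j=1..t. w j *\<^sub>R (d j - \<epsilon> *\<^sub>R 1)) = h - \<epsilon> *\<^sub>R 1"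
      using w(2) by (simp add: h_def scaleR_diff_right sum_subtractf flip: scaleR_sum_left sum_distrib_right)
    then have "h - \<epsilon> *\<^sub>R 1 \<in> ?N" using w(3) by simp
    ultimately have "\<delta> \<le> dist h (h - \<epsilon> *\<^sub>R 1)" using \<delta>(2) by blast
    also have "\<dots> = \<delta> / 2" using \<epsilon> n1 by (simp add: dist_norm) (simp add: \<epsilon>_def)
    finally show False using \<delta>(1) by simp
  qed
  with \<epsilon> show thesis by (rule that)
qed

section \<open>Necessity of pointedness\<close>

lemma quasi_concave_convex_superlevel:
  assumes "quasi_concave f"
  shows "convex {y. f y > r}"
  unfolding convex_def
proof (intro ballI allI impI)
  fix y z u v assume *: "y \<in> {y. f y > r}" "z \<in> {y. f y > r}" "0 \<le> u" "0 \<le> v" "u + v = (1::real)"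
  then have "f (u *\<^sub>R y + (1 - u) *\<^sub>R z) \<ge> min (f y) (f z)"
    using assms unfolding quasi_concave_def by auto
  moreover have v: "v = 1 - u" using *(5) by linarith
  ultimately show "u *\<^sub>R y + v *\<^sub>R z \<in> {y. f y > r}" unfolding v using *(1,2) by auto
qed

text \<open>Without pointedness some convex combination of the \<open>x j\<close> lies below
  \<open>x k\<close>. Monotonicity then bounds its value by \<open>\<theta> (x k)\<close>, while the
  convex strict superlevel set at that level contains all the \<open>x j\<close> and so the
  combination.\<close>

lemma pointed_prefcone_if_quasi_concave:
  fixes x :: "nat \<Rightarrow> real^'p"
  assumes "mono \<theta>" "quasi_concave \<theta>" "\<forall>j\<in>{1..t}. \<theta> (x j) > \<theta> (x k)"
  shows "pointed (prefcone x t k)"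
proof (rule ccontr)
  assume "\<not> ?thesis"
  then obtain w where w: "\<forall>j\<in>{1..t}. 0 \<le> w j" "(\<Sum>j=1..t. w j) = 1"
    "(\<Sum>j=1..t. w j *\<^sub>R (x j - x k)) \<le> 0"
    unfolding prefcone_eq_gencone by (rule not_pointed_gencone)
  have "(\<Sum>j=1..t. w j *\<^sub>R (x j - x k)) = (\<Sum>j=1..t. w j *\<^sub>R x j) - x k"
    using w(2) by (simp add: scaleR_diff_right sum_subtractf flip: scaleR_sum_left)
  then have "\<theta> (\<Sum>j=1..t. w j *\<^sub>R x j) \<le> \<theta> (x k)"
    using w(3) by (intro monoD[OF assms(1)]) simp
  moreover have "(\<Sum>j=1..t. w j *\<^sub>R x j) \<in> {y. \<theta> y > \<theta> (x k)}"
    using w(1,2) assms(3)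
    by (intro convex_sum quasi_concave_convex_superlevel assms) auto
  ultimately show False by simp
qed

section \<open>Superlevel sets of the signed distance\<close>

lemma le_infdist_iff:
  assumes "A \<noteq> {}"
  shows "r \<le> infdist y A \<longleftrightarrow> (\<forall>a\<in>A. r \<le> dist y a)"
  using assms by (auto simp: infdist_def le_cINF_iff intro: bdd_belowI2[of _ 0])

text \<open>A positive value forces \<open>y\<close> into \<open>C\<close>, where only the distance
  to the complement counts. For \<open>C = UNIV\<close> the equivalence would fail, because the
  distance to the empty set is 0.\<close>

lemma signed_dist_ge_pos:
  assumes "C \<noteq> UNIV" "0 < r"
  shows "r \<le> signed_dist C y \<longleftrightarrow> ball y r \<subseteq> C"
proof -
  have ball: "r \<le> infdist y (UNIV - C) \<longleftrightarrow> ball y r \<subseteq> C"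
  proof -
    have "UNIV - C \<noteq> {}" using assms(1) by blast
    moreover have "r \<le> dist y a \<longleftrightarrow> a \<notin> ball y r" for a by auto
    ultimately show ?thesis unfolding le_infdist_iff[OF \<open>UNIV - C \<noteq> {}\<close>] by blast
  qed
  show ?thesis
  proof (cases "y \<in> C")
    case True
    then show ?thesis by (simp add: signed_dist_def ball)
  next
    case False
    then have "signed_dist C y \<le> 0" by (simp add: signed_dist_def infdist_nonneg)
    moreover have "\<not> ball y r \<subseteq> C" using False assms(2) centre_in_ball[of y r] by blast
    ultimately show ?thesis using assms(2) by auto
  qed
qed

lemma signed_dist_ge_nonpos:
  assumes "r \<le> 0"
  shows "r \<le> signed_dist C y \<longleftrightarrow> infdist y C \<le> - r"
proof (cases "y \<in> C")
  case True
  then show ?thesis using assms infdist_nonneg[of y "UNIV - C"] by (simp add: signed_dist_def)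
next
  case False
  then show ?thesis by (auto simp: signed_dist_def)
qed

text \<open>\<open>A\<close> is not assumed closed, so the infimum may not be attained; the slack
  \<open>e\<close> replaces a nearest point.\<close>

lemma infdist_le_iff_approx:
  assumes "A \<noteq> {}"
  shows "infdist y A \<le> r \<longleftrightarrow> (\<forall>e>0. \<exists>a\<in>A. dist y a < r + e)"
proof (intro iffI allI impI)
  fix e :: real assume "infdist y A \<le> r" "e > 0"
  then have "\<not> r + e \<le> infdist y A" by simp
  then show "\<exists>a\<in>A. dist y a < r + e"
    unfolding le_infdist_iff[OF assms] by (simp add: not_le)
next
  assume approx: "\<forall>e>0. \<exists>a\<in>A. dist y a < r + e"
  show "infdist y A \<le> r"
  proof (rule field_le_epsilon)
    fix e :: real assume "e > 0"
    then obtain a where "a \<in> A" "dist y a < r + e" using approx by blast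
    then show "infdist y A \<le> r + e" using infdist_le2[of a A y "r + e"] by simp
  qed
qed

lemma convex_infdist_le:
  assumes "convex (C :: 'a::real_normed_vector set)" "C \<noteq> {}"
  shows "convex {y. infdist y C \<le> r}"
  unfolding convex_def
proof (intro ballI allI impI CollectI)
  fix y z :: 'a and u v :: real
  assume y: "y \<in> {y. infdist y C \<le> r}" and z: "z \<in> {y. infdist y C \<le> r}"
    and uv: "0 \<le> u" "0 \<le> v" "u + v = 1"
  show "infdist (u *\<^sub>R y + v *\<^sub>R z) C \<le> r"
    unfolding infdist_le_iff_approx[OF assms(2)]
  proof (intro allI impI)
    fix e :: real assume "e > 0"
    then obtain a b where a: "a \<in> C" "dist y a < r + e" and b: "b \<in> C" "dist z b < r + e"
      using y z infdist_le_iff_approx[OF assms(2)] by blast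
    have "u *\<^sub>R a + v *\<^sub>R b \<in> C" using assms(1) a b uv by (auto simp: convex_def)
    moreover have "dist (u *\<^sub>R y + v *\<^sub>R z) (u *\<^sub>R a + v *\<^sub>R b) < r + e"
    proof -
      have "u *\<^sub>R y + v *\<^sub>R z - (u *\<^sub>R a + v *\<^sub>R b) = u *\<^sub>R (y - a) + v *\<^sub>R (z - b)"
        by (simp add: algebra_simps)
      then have "dist (u *\<^sub>R y + v *\<^sub>R z) (u *\<^sub>R a + v *\<^sub>R b)
          \<le> u * norm (y - a) + v * norm (z - b)"
        unfolding dist_norm using norm_triangle_ineq[of "u *\<^sub>R (y - a)" "v *\<^sub>R (z - b)"] uv by simp
      also have "\<dots> < r + e"
        using a(2) b(2) uv by (intro convex_bound_lt) (auto simp: dist_norm)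
      finally show ?thesis .
    qed
    ultimately show "\<exists>a\<in>C. dist (u *\<^sub>R y + v *\<^sub>R z) a < r + e" by blast
  qed
qed

text \<open>Offsets from the centre present the set of admissible centres as an intersection of
  translates of \<open>C\<close>, which makes convexity and invariance under translations easy to
  transfer.\<close>

lemma ball_subset_iff: "ball y r \<subseteq> C \<longleftrightarrow> (\<forall>b\<in>ball 0 r. y + b \<in> C)"
  for y :: "'a::real_normed_vector"
proof -
  have "ball y r = (+) y ` ball 0 r" by simp
  then show ?thesis by (simp add: image_subset_iff del: image_add_ball)
qed

lemma convex_ball_subset:
  assumes "convex (C :: 'a::real_normed_vector set)"
  shows "convex {y. ball y r \<subseteq> C}"
  unfolding convex_def ball_subset_iff
proof (intro ballI allI impI CollectI)
  fix y z b :: 'a and u v :: real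
  assume *: "y \<in> {y. \<forall>b\<in>ball 0 r. y + b \<in> C}" "z \<in> {y. \<forall>b\<in>ball 0 r. y + b \<in> C}"
    "0 \<le> u" "0 \<le> v" "u + v = 1" "b \<in> ball 0 r"
  then have "u *\<^sub>R (y + b) + v *\<^sub>R (z + b) \<in> C"
    using assms unfolding convex_def by blast
  moreover have "u *\<^sub>R (y + b) + v *\<^sub>R (z + b) = u *\<^sub>R y + v *\<^sub>R z + b"
    using scaleR_add_left[of u v b] *(5) by (simp add: scaleR_add_right)
  ultimately show "u *\<^sub>R y + v *\<^sub>R z + b \<in> C" by simp
qed

lemma quasi_concave_signed_dist:
  assumes "convex C" "C \<noteq> {}" "C \<noteq> UNIV"
  shows "quasi_concave (signed_dist C)"
proof -
  have "convex {y. r \<le> signed_dist C y}" for r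
    using convex_ball_subset[OF assms(1)] convex_infdist_le[OF assms(1,2)] assms(3)
    by (cases "r > 0") (simp_all add: signed_dist_ge_pos signed_dist_ge_nonpos)
  \<comment> \<open>The level \<open>r\<close> is instantiated with the minimum of the two function
    values.\<close>
  from convexD[OF this] show ?thesis
    unfolding quasi_concave_def by simp
qed

lemma quasi_concave_translate:
  assumes "quasi_concave f"
  shows "quasi_concave (\<lambda>y. f (y - a))"
  unfolding quasi_concave_def
proof (intro allI ballI)
  fix y z and u :: real assume "u \<in> {0..1}"
  then have "f (u *\<^sub>R (y - a) + (1 - u) *\<^sub>R (z - a)) \<ge> min (f (y - a)) (f (z - a))"
    using assms unfolding quasi_concave_def by blast
  moreover have "u *\<^sub>R (y - a) + (1 - u) *\<^sub>R (z - a) = u *\<^sub>R y + (1 - u) *\<^sub>R z - a"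
    by (simp add: algebra_simps)
  ultimately show "min (f (y - a)) (f (z - a)) \<le> f (u *\<^sub>R y + (1 - u) *\<^sub>R z - a)" by simp
qed

text \<open>Translation by \<open>z - y\<close> maps \<open>C\<close> into itself. It carries a ball
  around \<open>y\<close> inside \<open>C\<close> to one around \<open>z\<close>, and points of
  \<open>C\<close> near \<open>y\<close> to points of \<open>C\<close> equally near
  \<open>z\<close>.\<close>

lemma mono_signed_dist:
  fixes C :: "(real^'p) set"
  assumes up: "\<And>c y. c \<in> C \<Longrightarrow> 0 \<le> y \<Longrightarrow> c + y \<in> C" and "C \<noteq> {}" "C \<noteq> UNIV"
  shows "mono (signed_dist C)"
proof
  fix y z :: "real^'p" assume "y \<le> z"
  then have yz: "0 \<le> z - y" by simp
  define r where "r = signed_dist C y"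
  then have r: "r \<le> signed_dist C y" by simp
  have "r \<le> signed_dist C z"
  proof (cases "r > 0")
    case True
    have "ball y r \<subseteq> C" using signed_dist_ge_pos[OF assms(3) True] r by simp
    then have "ball z r \<subseteq> C"
      unfolding ball_subset_iff using up[OF _ yz] by (metis add.assoc add.commute diff_add_cancel)
    then show ?thesis using signed_dist_ge_pos[OF assms(3) True] by simp
  next
    case False
    then have "infdist y C \<le> - r" using signed_dist_ge_nonpos[of r C y] r by simp
    moreover have "infdist z C \<le> infdist y C"
      unfolding le_infdist_iff[OF assms(2)]
    proof
      fix a assume "a \<in> C"
      then have "infdist z C \<le> dist z (a + (z - y))" by (intro infdist_le up yz)
      also have "\<dots> = dist y a" by (simp add: dist_norm)
      finally show "infdist z C \<le> dist y a" .
    qed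
    ultimately show ?thesis using signed_dist_ge_nonpos[of r C z] False by simp
  qed
  then show "signed_dist C y \<le> signed_dist C z" by (simp add: r_def)
qed

section \<open>The signed distance to the shifted cone\<close>

lemma pointed_ball_0:
  fixes C :: "(real^'p) set"
  assumes "pointed C" "r > 0"
  shows "\<not> ball 0 r \<subseteq> C"
proof
  assume sub: "ball 0 r \<subseteq> C"
  \<comment> \<open>A multiple of the all-ones vector of norm \<open>r / 2\<close>: it and its
    negative both lie in the ball.\<close>
  define v where "v = (r / (2 * norm (1::real^'p))) *\<^sub>R (1::real^'p)"
  have "norm v < r" using assms(2) by (simp add: v_def)
  then have "v \<in> C" "- v \<in> C" using sub by auto
  then have "v = 0" using pointed_eq_0[OF assms(1)] by blast
  then show False using assms(2) by (simp add: v_def)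
qed

lemma signed_dist_prefcone_eps_separates:
  fixes x :: "nat \<Rightarrow> real^'p"
  assumes "\<epsilon> > 0" and pt: "pointed (prefcone_eps \<epsilon> x t k)"
  defines "\<theta> \<equiv> \<lambda>y. signed_dist (prefcone_eps \<epsilon> x t k) (y - x k)"
  shows "mono \<theta>" "quasi_concave \<theta>" "\<forall>j\<in>{1..t}. \<theta> (x j) > \<theta> (x k)"
proof -
  define d where "d j = x j - \<epsilon> *\<^sub>R 1 - x k" for j
  define C where "C = gencone d t"
  have C: "prefcone_eps \<epsilon> x t k = C"
    unfolding prefcone_eps_eq_gencone C_def d_def ..
  have ptC: "pointed C" using pt C by simp
  have ne: "C \<noteq> {}" using gencone_convex_cone(3) C_def by blast
  have nU: "C \<noteq> UNIV" using pointed_ball_0[OF ptC, of 1] by auto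
  have up: "c + y \<in> C" if "c \<in> C" "0 \<le> y" for c y
    using that gencone_add nonneg_in_gencone unfolding C_def by blast
  have "mono (signed_dist C)" using up ne nU by (rule mono_signed_dist)
  then show "mono \<theta>" unfolding \<theta>_def C mono_def by (simp add: diff_right_mono)
  show "quasi_concave \<theta>"
    unfolding \<theta>_def C
    by (intro quasi_concave_translate quasi_concave_signed_dist ne nU)
      (simp add: C_def gencone_convex_cone)
  \<comment> \<open>A positive value would itself be the radius of a ball around 0 inside the
    pointed cone.\<close>
  have "\<not> signed_dist C 0 > 0"
    using signed_dist_ge_pos[OF nU, of "signed_dist C 0" 0] pointed_ball_0[OF ptC] by blast
  then have "\<theta> (x k) \<le> 0" by (simp add: \<theta>_def C)
  \<comment> \<open>The shift yields the gap: \<open>x j - x k\<close> equals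
    \<open>d j + \<epsilon> *\<^sub>R 1\<close>, and any \<open>b\<close> of norm below
    \<open>\<epsilon>\<close> has components at least \<open>- \<epsilon>\<close>, so adding
    \<open>b\<close> still leaves \<open>d j\<close> plus a nonnegative vector.\<close>
  moreover have "\<epsilon> \<le> \<theta> (x j)" if j: "j \<in> {1..t}" for j
    unfolding \<theta>_def C signed_dist_ge_pos[OF nU assms(1)] ball_subset_iff
  proof
    fix b :: "real^'p" assume "b \<in> ball 0 \<epsilon>"
    then have "\<bar>b $ i\<bar> \<le> \<epsilon>" for i using component_le_norm_cart[of b i] by simp
    then have "- \<epsilon> \<le> b $ i" for i by (metis abs_le_D2 minus_le_iff)
    then have "0 \<le> \<epsilon> *\<^sub>R 1 + b" by (simp add: less_eq_vec_def) (metis add.commute add.right_inverse add_right_mono)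
    then have "d j + (\<epsilon> *\<^sub>R 1 + b) \<in> C"
      using up generator_in_gencone[OF j] unfolding C_def by blast
    then show "x j - x k + b \<in> C" by (simp add: d_def algebra_simps)
  qed
  ultimately show "\<forall>j\<in>{1..t}. \<theta> (x j) > \<theta> (x k)" using assms(1) by fastforce
qed

theorem corollary2:
  fixes x :: "nat \<Rightarrow> real^'p" and m t k :: nat
  assumes "inj_on x {1..m}"
    and "1 \<le> t" and "t < m"
    and "k \<in> {1..m} - {1..t}"
  shows
    "((\<exists>\<theta> :: real^'p \<Rightarrow> real.
         mono \<theta> \<and> quasi_concave \<theta> \<and> (\<forall>j\<in>{1..t}. \<theta> (x j) > \<theta> (x k)))
       \<longleftrightarrow> pointed (prefcone x t k))
     \<and> (pointed (prefcone x t k) \<longrightarrow>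
         (\<exists>\<epsilon>>0. pointed (prefcone_eps \<epsilon> x t k)) \<and>
         (\<forall>\<epsilon>>0. pointed (prefcone_eps \<epsilon> x t k) \<longrightarrow>
            (let \<theta> = (\<lambda>y. signed_dist (prefcone_eps \<epsilon> x t k) (y - x k))
             in mono \<theta> \<and> quasi_concave \<theta> \<and> (\<forall>j\<in>{1..t}. \<theta> (x j) > \<theta> (x k)))))"
proof -
  \<comment> \<open>Injectivity of \<open>x\<close> and \<open>k\<close> lying outside
    \<open>{1..t}\<close> make every generator nonzero, as the perturbation requires.\<close>
  have nz: "x j - x k \<noteq> 0" if "j \<in> {1..t}" for j
    using assms that by (auto dest: inj_onD)
  have eps: "\<exists>\<epsilon>>0. pointed (prefcone_eps \<epsilon> x t k)" if pt: "pointed (prefcone x t k)"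
  proof -
    obtain \<epsilon> where "\<epsilon> > 0" "pointed (gencone (\<lambda>j. x j - x k - \<epsilon> *\<^sub>R 1) t)"
      using pt nz unfolding prefcone_eq_gencone by (rule pointed_gencone_perturb)
    moreover have "x j - x k - \<epsilon> *\<^sub>R 1 = x j - \<epsilon> *\<^sub>R 1 - x k" for j
      by (simp add: algebra_simps)
    ultimately show ?thesis unfolding prefcone_eps_eq_gencone by auto
  qed
  \<comment> \<open>The signed distance for the parameter supplied by \<open>eps\<close> is also the
    witness for sufficiency in the equivalence.\<close>
  show ?thesis
    unfolding Let_def
    using eps signed_dist_prefcone_eps_separates[of _ x t k] pointed_prefcone_if_quasi_concave[of _ t x k] by blast
qed

end
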